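(* Let $\alpha$ be an irrational number and let $q$ be a best approximation denominator for $\alpha$. Then $$1\le \prod_{n=1}^{q-1}|2\sin(\pi n\alpha)|\le \frac{q^2}{2}.$$
   Context: The best approximation denominators of an irrational $\alpha$ are the denominators $q_0,q_1,q_2,\dots$ of the convergents $p_i/q_i$ of its continued fraction expansion $\alpha=[a_0;a_1,a_2,\dots]$, i.e. $q_0=1$, $q_1=a_1$, $q_{i+1}=a_{i+1}q_i+q_{i-1}$ for $i\ge1$.
   Formalization: The upper bound q²/2 is stated only for q ≠ 1: for q = q_0 = 1 the product is empty, equal to 1, and the bound would read 1 ≤ 1/2, which is false; the lower bound is stated for all q. *)

theory Defs
  imports "HOL-Analysis.Analysis"
begin

text \<open>
  Simple continued fraction expansion \<open>\<alpha> = [a\<^sub>0; a\<^sub>1, a\<^sub>2, \<dots>]\<close>, intended for irrational \<open>\<alpha>\<close>: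
  \<open>cf_rest \<alpha> i\<close> is the tail \<open>[a\<^sub>i; a\<^sub>i\<^sub>+\<^sub>1, \<dots>]\<close>, so that \<open>a\<^sub>i\<close> is its floor and the next tail is
  the reciprocal of its fractional part (which never vanishes for irrational \<open>\<alpha>\<close>).
\<close>

primrec cf_rest :: "real \<Rightarrow> nat \<Rightarrow> real" where
  "cf_rest \<alpha> 0 = \<alpha>"
| "cf_rest \<alpha> (Suc i) = 1 / frac (cf_rest \<alpha> i)"

definition cf_coeff :: "real \<Rightarrow> nat \<Rightarrow> int" where
  "cf_coeff \<alpha> i = \<lfloor>cf_rest \<alpha> i\<rfloor>"

fun cf_denom :: "real \<Rightarrow> nat \<Rightarrow> int" where
  "cf_denom \<alpha> 0 = 1"
| "cf_denom \<alpha> (Suc 0) = cf_coeff \<alpha> 1"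
| "cf_denom \<alpha> (Suc (Suc i)) = cf_coeff \<alpha> (Suc (Suc i)) * cf_denom \<alpha> (Suc i) + cf_denom \<alpha> i"

text \<open>For irrational \<open>\<alpha>\<close> all values of \<^const>\<open>cf_denom\<close> are positive, so none is lost by taking \<open>q\<close> in \<^typ>\<open>nat\<close>.\<close>

definition best_approx_denom :: "real \<Rightarrow> nat \<Rightarrow> bool" where
  "best_approx_denom \<alpha> q \<longleftrightarrow> (\<exists>i. int q = cf_denom \<alpha> i)"

end

theory Submission
  imports Defs "HOL-Number_Theory.Modular_Inverse"
begin

text \<open>
  Let \<open>p / q\<close> be a convergent and \<open>x = q \<alpha> - p\<close>; replacing \<open>\<alpha>\<close> by \<open>- \<alpha>\<close> we may assume \<open>x > 0\<close>.
  With \<open>r = n p mod q\<close> the \<open>n\<close>-th factor is \<open>2 sin (\<pi> (r + n x) / q)\<close> with \<open>0 \<le> n x \<le> 1\<close>, and \<open>r\<close>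
  runs through \<open>1, \<dots>, q - 1\<close>. By concavity of the sine each factor lies between its neighbours
  \<open>s r\<close> and \<open>s (r + 1)\<close>, where \<open>s r = 2 sin (\<pi> r / q)\<close>, except that the factor next to the maximum
  is only bounded by \<open>2\<close>. Since the product of all \<open>s r\<close> is \<open>q\<close>, shifting the indices
  on one side of the maximum costs a factor of at most \<open>2 / s 1 \<le> q / 2\<close> from above.
  From below, the shift loses the factor at the maximum, which is at most \<open>2\<close>, and leaves the factor
  with \<open>r = q - 1\<close>. That factor has \<open>n\<close> equal to the previous denominator \<open>q'\<close>,
  and \<open>q' x \<le> 1 / 2\<close>, so it is at least \<open>2 sin (\<pi> / (2 q)) \<ge> 2 / q\<close>.
\<close>

section \<open>Roots of unity and the sine product at rational points\<close>

lemma norm_one_minus_cis: "norm (1 - cis t) = 2 * \<bar>sin (t / 2)\<bar>"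
proof (rule power2_eq_imp_eq)
  have "(norm (1 - cis t))\<^sup>2 = (1 - cos t)\<^sup>2 + (sin t)\<^sup>2"
    by (simp add: cmod_power2)
  also have "\<dots> = 2 - 2 * cos (2 * (t / 2))"
    using sin_cos_squared_add[of t] by (simp add: power2_eq_square algebra_simps)
  also have "\<dots> = (2 * \<bar>sin (t / 2)\<bar>)\<^sup>2"
    by (subst cos_double_sin) (simp add: power_mult_distrib)
  finally show "(norm (1 - cis t))\<^sup>2 = (2 * \<bar>sin (t / 2)\<bar>)\<^sup>2" .
qed auto

text \<open>The polynomial \<open>1 + z + ... + z ^ (q - 1)\<close> is the product of
  \<open>z - w k\<close> over the nontrivial \<open>q\<close>-th roots of unity. At
  \<open>z = 1\<close> its value is \<open>q\<close>, and each factor has as norm a chord length of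
  the unit circle.\<close>

lemma prod_sin_rational:
  assumes "q > 0"
  shows "(\<Prod>r = 1..<q. 2 * sin (pi * real r / real q)) = real q"
proof -
  define w where "w = (\<lambda>k. cis (2 * pi * real k / real q))"
  have bij: "bij_betw w {..<q} {z. z ^ q = 1}"
    unfolding w_def by (rule Complex.bij_betw_roots_unity[OF assms])
  have inj: "inj_on w {1..<q}"
    using bij by (auto simp: bij_betw_def intro: inj_on_subset)
  have w0: "w 0 = 1"
    by (simp add: w_def)
  have w1: "w k \<noteq> 1" if "k \<in> {1..<q}" for k
    using inj_onD[OF bij_betw_imp_inj_on[OF bij], of k 0] that w0 assms by auto
  have wq: "w k ^ q = 1" if "k \<in> {1..<q}" for k
    using bij_betwE[OF bij] that by auto
  define P where "P = (\<Prod>k = 1..<q. [:- w k, 1:])"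
  define Q where "Q = (\<Sum>i<q. monom (1::complex) i)"
  have degP: "degree P = q - 1"
    unfolding P_def by (subst degree_prod_eq_sum_degree) auto
  have "P = Q"
  \<comment> \<open>Equal coefficients at \<open>q - 1\<close> push the degree of
    \<open>P - Q\<close> below \<open>q - 1\<close>, so agreement at the \<open>q - 1\<close>
    nontrivial roots suffices.\<close>
  proof (rule poly_eqI_degree_lead_coeff[where n = "q - 1" and A = "w ` {1..<q}"])
    have "lead_coeff P = 1"
      unfolding P_def lead_coeff_prod by simp
    then have "coeff P (q - 1) = 1"
      by (simp add: degP)
    moreover have "coeff Q (q - 1) = 1"
      using assms by (simp add: Q_def coeff_sum)
    ultimately show "coeff P (q - 1) = coeff Q (q - 1)"
      by simp
    show "q - 1 \<le> card (w ` {1..<q})"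
      using card_image[OF inj] by simp
    show "degree P \<le> q - 1"
      by (simp add: degP)
    show "degree Q \<le> q - 1"
      unfolding Q_def by (intro degree_sum_le) (auto intro: order.trans[OF degree_monom_le])
    fix z assume "z \<in> w ` {1..<q}"
    then obtain k where k: "k \<in> {1..<q}" "z = w k"
      by auto
    have "poly P z = 0"
      unfolding P_def poly_prod using k by (intro prod_zero) auto
    moreover have "poly Q z = 0"
      unfolding Q_def poly_sum using k wq[of k] w1[of k]
      by (simp add: poly_monom geometric_sum)
    ultimately show "poly P z = poly Q z"
      by simp
  qed
  then have "poly P 1 = poly Q 1"
    by simp
  then have "(\<Prod>k = 1..<q. 1 - w k) = of_nat q"
    by (simp add: P_def Q_def poly_prod poly_sum poly_monom)
  then have "(\<Prod>k = 1..<q. norm (1 - w k)) = real q"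
    by (metis norm_of_nat prod_norm)
  moreover have "norm (1 - w k) = 2 * sin (pi * real k / real q)" if "k \<in> {1..<q}" for k
  proof -
    have "0 \<le> sin (pi * real k / real q)"
      using that by (intro sin_ge_zero) (auto simp: field_simps)
    then show ?thesis
      by (simp add: w_def norm_one_minus_cis)
  qed
  ultimately show ?thesis
    by simp
qed

section \<open>Concavity of the sine and comparison with neighbouring grid points\<close>

lemma concave_on_sin: "concave_on {0..pi} sin"
  by (rule f''_le0_imp_concave[where f' = cos and f'' = "\<lambda>x. - sin x"])
     (auto intro!: derivative_eq_intros sin_ge_zero)

lemma sin_ge_min:
  assumes "0 \<le> a" "b \<le> pi" "x \<in> {a..b}"
  shows "min (sin a) (sin b) \<le> sin x"
proof (rule concave_on_ge_min[where f = sin])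
  show "concave_on {a..b} sin"
    using convex_on_subset[of "{0..pi}" "\<lambda>x. - sin x" "{a..b}"] concave_on_sin assms
    by (simp add: concave_on_def)
qed (use assms in auto)

text \<open>Jordan's inequality: by concavity the sine lies above its chord from \<open>0\<close> to
  \<open>pi / 2\<close>. It yields the constants in both the upper and the lower bound.\<close>

lemma sin_pi_ge:
  assumes "0 \<le> x" "x \<le> 1 / 2"
  shows "2 * x \<le> sin (pi * x)"
  using concave_onD[OF concave_on_sin, of "2 * x" 0 "pi / 2"] assms by (simp add: mult.commute)

lemma abs_sin_add_int_pi: "\<bar>sin (x + pi * real_of_int k)\<bar> = \<bar>sin x\<bar>"
  by (simp add: sin_add cos_npi_int)

lemma prod_split_at:
  fixes f :: "nat \<Rightarrow> real"
  assumes "1 \<le> h" "h < q"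
  shows "(\<Prod>r = 1..<q. f r) = (\<Prod>r = 1..<h. f r) * f h * (\<Prod>r = Suc h..<q. f r)"
proof -
  have "(\<Prod>r = 1..<q. f r) = (\<Prod>r = 1..<h. f r) * (\<Prod>r = h..<q. f r)"
    using assms by (intro prod.atLeastLessThan_concat[symmetric]) auto
  then show ?thesis
    using assms by (simp add: prod.atLeast_Suc_lessThan mult.assoc)
qed


text \<open>Monotonicity on each half of \<open>{0..pi}\<close>: \<open>r < q div 2\<close> keeps
  \<open>r + 1\<close> at or before \<open>q / 2\<close>, and \<open>q div 2 < r\<close> puts
  \<open>r\<close> at or past it. The cell \<open>r = q div 2\<close> is left out because the
  maximum can lie inside it.\<close>

lemma sin_between_upper:
  assumes "r + 1 \<le> q" "0 \<le> t" "t \<le> 1"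
  shows "r < q div 2 \<Longrightarrow> sin (pi * (real r + t) / real q) \<le> sin (pi * real (r + 1) / real q)"
    and "q div 2 < r \<Longrightarrow> sin (pi * (real r + t) / real q) \<le> sin (pi * real r / real q)"
proof -
  have q: "0 < real q"
    using assms by simp
  {
    assume "r < q div 2"
    then have "2 * (r + 1) \<le> q"
      by presburger
    then have r: "2 * (real r + 1) \<le> real q"
      by (simp flip: of_nat_le_iff[where 'a = real])
    have "pi * (2 * (real r + 1)) \<le> pi * real q"
      by (intro mult_left_mono r) simp
    then show "sin (pi * (real r + t) / real q) \<le> sin (pi * real (r + 1) / real q)"
      using q assms pi_gt_zero
      by (intro sin_monotone_2pi_le)
         (auto simp: field_simps intro: order.trans[of _ 0] add_nonneg_nonneg mult_nonneg_nonneg)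
  next
    assume "q div 2 < r"
    then have "q \<le> 2 * r"
      by linarith
    then have r: "real q \<le> 2 * real r"
      by (simp flip: of_nat_le_iff[where 'a = real])
    \<comment> \<open>Reflection in \<open>q / 2\<close> carries the right half to the left one,
      where the sine increases.\<close>
    have flip: "sin (pi * y / real q) = sin (pi * (real q - y) / real q)" for y
      using q sin_pi_minus[of "pi * y / real q"] by (simp add: field_simps)
    have "sin (pi * (real q - (real r + t)) / real q) \<le> sin (pi * (real q - real r) / real q)"
    proof (rule sin_monotone_2pi_le)
      show "pi * (real q - (real r + t)) / real q \<le> pi * (real q - real r) / real q"
        using q assms by (intro divide_right_mono mult_left_mono) auto
      have "0 \<le> pi * (real q - (real r + t)) / real q"
        using q assms by (intro divide_nonneg_pos mult_nonneg_nonneg) auto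
      then show "- (pi / 2) \<le> pi * (real q - (real r + t)) / real q"
        using pi_gt_zero by linarith
      have "pi * (2 * (real q - real r)) \<le> pi * real q"
        using r by (intro mult_left_mono) auto
      then show "pi * (real q - real r) / real q \<le> pi / 2"
        using q by (simp add: field_simps)
    qed
    then show "sin (pi * (real r + t) / real q) \<le> sin (pi * real r / real q)"
      by (simp only: flip[symmetric])
  }
qed

text \<open>By concavity the minimum over a cell is at an endpoint. The hypothesis tells on which
  side of \<open>q / 2\<close> the midpoint \<open>r + 1 / 2\<close> lies, hence which endpoint has
  the smaller value; here every cell is covered.\<close>

lemma sin_between_lower:
  assumes "r + 1 \<le> q" "0 \<le> t" "t \<le> 1"
  shows "r \<le> (q - 1) div 2 \<Longrightarrow> sin (pi * real r / real q) \<le> sin (pi * (real r + t) / real q)"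
    and "(q - 1) div 2 < r \<Longrightarrow> sin (pi * real (r + 1) / real q) \<le> sin (pi * (real r + t) / real q)"
proof -
  have q: "0 < real q"
    using assms by simp
  have flip: "sin (pi * y / real q) = sin (pi * (real q - y) / real q)" for y
    using q sin_pi_minus[of "pi * y / real q"] by (simp add: field_simps)
  have mono: "sin (pi * y / real q) \<le> sin (pi * z / real q)" if "0 \<le> y" "y \<le> z" "2 * z \<le> real q" for y z
  proof (rule sin_monotone_2pi_le)
    show "pi * y / real q \<le> pi * z / real q"
      using q that by (intro divide_right_mono mult_left_mono) auto
    have "0 \<le> pi * y / real q"
      using q that by (intro divide_nonneg_pos mult_nonneg_nonneg) auto
    then show "- (pi / 2) \<le> pi * y / real q"
      using pi_gt_zero by linarith
    have "pi * (2 * z) \<le> pi * real q"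
      using that by (intro mult_left_mono) auto
    then show "pi * z / real q \<le> pi / 2"
      using q by (simp add: field_simps)
  qed
  have mn: "min (sin (pi * real r / real q)) (sin (pi * real (r + 1) / real q))
      \<le> sin (pi * (real r + t) / real q)"
  proof (rule sin_ge_min)
    have "pi * real (r + 1) \<le> pi * real q"
      using assms by (intro mult_left_mono) auto
    then show "pi * real (r + 1) / real q \<le> pi"
      using q by (simp add: field_simps)
    show "pi * (real r + t) / real q \<in> {pi * real r / real q..pi * real (r + 1) / real q}"
      using q assms by (auto intro!: divide_right_mono mult_left_mono)
  qed simp
  {
    assume "r \<le> (q - 1) div 2"
    with assms have "2 * r + 1 \<le> q"
      by linarith
    then have r: "2 * real r + 1 \<le> real q"
      by (simp flip: of_nat_le_iff[where 'a = real])
    have "sin (pi * real r / real q) \<le> sin (pi * real (r + 1) / real q)"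
    proof (cases "2 * real (r + 1) \<le> real q")
      case True
      then show ?thesis
        by (intro mono) auto
    next
      \<comment> \<open>The point \<open>q / 2\<close> now lies inside the cell. Since
        \<open>r \<le> q - (r + 1)\<close>, reflecting the right endpoint puts both points in the
        increasing half.\<close>
      case False
      with r assms have "sin (pi * real r / real q) \<le> sin (pi * (real q - real (r + 1)) / real q)"
        by (intro mono) auto
      then show ?thesis
        by (simp only: flip[symmetric])
    qed
    with mn show "sin (pi * real r / real q) \<le> sin (pi * (real r + t) / real q)"
      by linarith
  next
    assume "(q - 1) div 2 < r"
    then have "q \<le> 2 * r + 1"
      by linarith
    then have r: "real q \<le> 2 * real r + 1"
      by (simp flip: of_nat_le_iff[where 'a = real])
    have "sin (pi * real (r + 1) / real q) \<le> sin (pi * real r / real q)"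
    proof (cases "2 * real r \<le> real q")
      case True
      with r assms have "sin (pi * (real q - real (r + 1)) / real q) \<le> sin (pi * real r / real q)"
        by (intro mono) auto
      then show ?thesis
        by (simp only: flip[symmetric])
    next
      case False
      with assms have "sin (pi * (real q - real (r + 1)) / real q) \<le> sin (pi * (real q - real r) / real q)"
        by (intro mono) auto
      then show ?thesis
        by (simp only: flip[symmetric])
    qed
    with mn show "sin (pi * real (r + 1) / real q) \<le> sin (pi * (real r + t) / real q)"
      by linarith
  }
qed

section \<open>Products over a permuted and perturbed grid: \<open>\<rho> n\<close> will be
  \<open>n p mod q\<close> and \<open>t n\<close> the displacement \<open>n x\<close>\<close>

context
  fixes \<rho> :: "nat \<Rightarrow> nat" and t :: "nat \<Rightarrow> real" and q :: nat
  assumes q: "2 \<le> q"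
    and bij: "bij_betw \<rho> {1..<q} {1..<q}"
    and t: "\<And>n. n \<in> {1..<q} \<Longrightarrow> 0 \<le> t n \<and> t n \<le> 1"
begin

lemma prod_perturbed_sin_le:
  "(\<Prod>n = 1..<q. 2 * sin (pi * (real (\<rho> n) + t n) / real q)) \<le> (real q)\<^sup>2 / 2"
proof -
  define s where "s = (\<lambda>r. 2 * sin (pi * real r / real q))"
  define h where "h = q div 2"
  \<comment> \<open>Cells left of the maximum take their right neighbour, cells right of it their
    left neighbour, and the cell \<open>h\<close> only the trivial bound \<open>2\<close>.\<close>
  define U where "U = (\<lambda>r. if r < h then s (Suc r) else if r = h then 2 else s r)"
  have h: "1 \<le> h" "h < q"
    using q by (auto simp: h_def)
  have s_pos: "0 < s r" if "r \<in> {1..<q}" for r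
    unfolding s_def using that by (intro mult_pos_pos sin_gt_zero) (auto simp: field_simps)
  have range: "\<rho> n \<in> {1..<q}" if "n \<in> {1..<q}" for n
    using bij_betwE[OF bij] that by auto
  have le_U: "2 * sin (pi * (real (\<rho> n) + t n) / real q) \<le> U (\<rho> n)" if n: "n \<in> {1..<q}" for n
    using sin_between_upper[of "\<rho> n" q "t n"] range[OF n] t[OF n]
    by (auto simp: U_def s_def h_def)
  have nonneg: "0 \<le> 2 * sin (pi * (real (\<rho> n) + t n) / real q)" if n: "n \<in> {1..<q}" for n
  proof -
    have "pi * (real (\<rho> n) + t n) \<le> pi * real q"
      using range[OF n] t[OF n] by (intro mult_left_mono) auto
    then show ?thesis
      using q t[OF n] by (intro mult_nonneg_nonneg sin_ge_zero) (auto simp: field_simps)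
  qed
  have "(\<Prod>n = 1..<q. 2 * sin (pi * (real (\<rho> n) + t n) / real q)) \<le> (\<Prod>n = 1..<q. U (\<rho> n))"
    by (intro prod_mono) (use le_U nonneg in auto)
  also have "\<dots> = (\<Prod>r = 1..<q. U r)"
    by (rule prod.reindex_bij_betw[OF bij])
  also have "\<dots> = (\<Prod>r = 1..<h. s (Suc r)) * 2 * (\<Prod>r = Suc h..<q. s r)"
    unfolding prod_split_at[OF h] by (simp add: U_def)
  finally have le: "(\<Prod>n = 1..<q. 2 * sin (pi * (real (\<rho> n) + t n) / real q)) \<le>
    (\<Prod>r = 1..<h. s (Suc r)) * 2 * (\<Prod>r = Suc h..<q. s r)" .
  \<comment> \<open>The shifted left part has indices \<open>2, ..., h\<close> and the right part
    \<open>h + 1, ..., q - 1\<close>, so only \<open>s 1\<close> is missing from the full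
    product.\<close>
  have "s 1 * (\<Prod>r = 1..<h. s (Suc r)) = (\<Prod>r = 1..<Suc h. s r)"
    using h by (simp add: prod.atLeast_Suc_lessThan prod.shift_bounds_Suc_ivl[symmetric] del: prod.op_ivl_Suc)
  moreover have "(\<Prod>r = 1..<Suc h. s r) * (\<Prod>r = Suc h..<q. s r) = (\<Prod>r = 1..<q. s r)"
    using h by (intro prod.atLeastLessThan_concat) auto
  ultimately have "s 1 * ((\<Prod>r = 1..<h. s (Suc r)) * 2 * (\<Prod>r = Suc h..<q. s r)) = 2 * (\<Prod>r = 1..<q. s r)"
    by (metis mult.assoc mult.left_commute)
  also have "\<dots> = 2 * real q"
    using q prod_sin_rational[of q] by (simp add: s_def)
  finally have eq: "(\<Prod>r = 1..<h. s (Suc r)) * 2 * (\<Prod>r = Suc h..<q. s r) = 2 * real q / s 1"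
    using s_pos[of 1] q by (simp add: field_simps)
  have "4 / real q \<le> s 1"
    using sin_pi_ge[of "1 / real q"] q by (simp add: s_def field_simps)
  then have "2 * real q / s 1 \<le> 2 * real q / (4 / real q)"
    using q by (intro divide_left_mono mult_pos_pos s_pos) auto
  also have "\<dots> = (real q)\<^sup>2 / 2"
    by (simp add: power2_eq_square)
  finally show ?thesis
    using le eq by simp
qed

text \<open>The right neighbour of the cell \<open>q - 1\<close> is \<open>q\<close>, where the sine
  vanishes, so comparison with grid values is useless there. The hypothesis \<open>last\<close>
  keeps that one point at least half a cell away from the zero.\<close>

lemma prod_perturbed_sin_ge:
  assumes last: "\<And>n. n \<in> {1..<q} \<Longrightarrow> \<rho> n = q - 1 \<Longrightarrow> t n \<le> 1 / 2"
  shows "1 \<le> (\<Prod>n = 1..<q. 2 * sin (pi * (real (\<rho> n) + t n) / real q))"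
proof -
  define s where "s = (\<lambda>r. 2 * sin (pi * real r / real q))"
  define h where "h = Suc ((q - 1) div 2)"
  \<comment> \<open>Outside the exceptional cell each value is the smaller endpoint;
    \<open>h\<close> is the first index at which this is the right one.\<close>
  define L where "L = (\<lambda>r. if r = q - 1 then 2 / real q else if r < h then s r else s (Suc r))"
  have h: "1 \<le> h" "h < q"
    using q by (auto simp: h_def)
  have s_pos: "0 < s r" if "r \<in> {1..<q}" for r
    unfolding s_def using that by (intro mult_pos_pos sin_gt_zero) (auto simp: field_simps)
  have range: "\<rho> n \<in> {1..<q}" if "n \<in> {1..<q}" for n
    using bij_betwE[OF bij] that by auto
  have L_le: "L (\<rho> n) \<le> 2 * sin (pi * (real (\<rho> n) + t n) / real q)" if n: "n \<in> {1..<q}" for n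
  proof (cases "\<rho> n = q - 1")
    case True
    have tn: "0 \<le> t n" "t n \<le> 1 / 2"
      using t[OF n] last[OF n True] by auto
    \<comment> \<open>The distance to the zero at \<open>q\<close> is
      \<open>1 - t n \<ge> 1 / 2\<close>; Jordan's inequality is applied to the reflected
      angle.\<close>
    have "1 / real q \<le> 2 * ((1 - t n) / real q)"
      using q tn by (simp add: field_simps)
    also have "\<dots> \<le> sin (pi * ((1 - t n) / real q))"
      using q tn by (intro sin_pi_ge) (auto simp: field_simps)
    also have "\<dots> = sin (pi - pi * ((1 - t n) / real q))"
      by simp
    also have "pi - pi * ((1 - t n) / real q) = pi * (real (\<rho> n) + t n) / real q"
      using q True by (simp add: of_nat_diff field_simps)
    finally show ?thesis
      using True by (simp add: L_def)
  next
    case False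
    then show ?thesis
      using sin_between_lower[of "\<rho> n" q "t n"] range[OF n] t[OF n]
      by (auto simp: L_def s_def h_def)
  qed
  have L_nonneg: "0 \<le> L r" if "r \<in> {1..<q}" for r
    using that s_pos[of r] s_pos[of "Suc r"] by (auto simp: L_def intro: less_imp_le)
  have "(\<Prod>r = 1..<q - 1. L r) = (\<Prod>r = 1..<h. L r) * (\<Prod>r = h..<q - 1. L r)"
    using h by (intro prod.atLeastLessThan_concat[symmetric]) auto
  also have "(\<Prod>r = 1..<h. L r) = (\<Prod>r = 1..<h. s r)"
    by (intro prod.cong) (use h in \<open>auto simp: L_def\<close>)
  also have "(\<Prod>r = h..<q - 1. L r) = (\<Prod>r = h..<q - 1. s (Suc r))"
    by (intro prod.cong) (auto simp: L_def)
  also have "\<dots> = (\<Prod>r = Suc h..<q. s r)"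
    using q prod.shift_bounds_Suc_ivl[of s h "q - 1"] by simp
  \<comment> \<open>The indices present are \<open>1, ..., h - 1\<close> and
    \<open>h + 1, ..., q - 1\<close>, so the skipped factor is \<open>s h\<close>.\<close>
  finally have "(\<Prod>r = 1..<q - 1. L r) * s h = (\<Prod>r = 1..<q. s r)"
    unfolding prod_split_at[OF h] by simp
  also have "\<dots> = real q"
    using q prod_sin_rational[of q] by (simp add: s_def)
  finally have "(\<Prod>r = 1..<q - 1. L r) = real q / s h"
    using s_pos[of h] h by (simp add: field_simps)
  moreover have "(\<Prod>r = 1..<q. L r) = (\<Prod>r = 1..<q - 1. L r) * (2 / real q)"
    using q by (subst prod_split_at[of "q - 1"]) (auto simp: L_def)
  ultimately have prod_L: "(\<Prod>r = 1..<q. L r) = 2 / s h"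
    using q by simp
  have "s h \<le> 2"
    by (simp add: s_def)
  then have "1 \<le> (\<Prod>r = 1..<q. L r)"
    unfolding prod_L using s_pos[of h] h by simp
  also have "\<dots> = (\<Prod>n = 1..<q. L (\<rho> n))"
    by (rule prod.reindex_bij_betw[OF bij, symmetric])
  also have "\<dots> \<le> (\<Prod>n = 1..<q. 2 * sin (pi * (real (\<rho> n) + t n) / real q))"
    by (intro prod_mono) (use L_le L_nonneg range in auto)
  finally show ?thesis .
qed

end

section \<open>Sine products at the denominator of a convergent\<close>

text \<open>The congruence makes \<open>- m\<close> an inverse of \<open>p\<close> modulo
  \<open>q\<close>: hence \<open>n p mod q\<close> permutes the nonzero residues, and the residue
  \<open>q - 1\<close> occurs exactly at \<open>n = m\<close>. The bound on
  \<open>2 * real m * x\<close> then gives the condition on the last cell.\<close>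

lemma sudler_bounds_above_convergent:
  fixes \<alpha> x :: real and p :: int and q m :: nat
  assumes q: "2 \<le> q" and m: "1 \<le> m" "m < q"
    and cong: "[p * int m = - 1] (mod int q)"
    and x: "x = real q * \<alpha> - of_int p" "0 \<le> x" "real q * x \<le> 1" "2 * real m * x \<le> 1"
  shows "1 \<le> (\<Prod>n = 1..<q. \<bar>2 * sin (pi * real n * \<alpha>)\<bar>)"
    and "(\<Prod>n = 1..<q. \<bar>2 * sin (pi * real n * \<alpha>)\<bar>) \<le> (real q)\<^sup>2 / 2"
proof -
  have "[p * (- int m) = 1] (mod int q)"
    using cong_minus_minus_iff[of "p * int m" "-1" "int q"] cong by simp
  then have cop: "coprime p (int q)"
    using coprime_iff_invertible_int by blast
  define \<sigma> where "\<sigma> = (\<lambda>k. p * k mod int q)"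
  define \<rho> where "\<rho> = (\<lambda>n. nat (\<sigma> (int n)))"
  have bij\<sigma>: "bij_betw \<sigma> {1..<int q} {1..<int q}"
    unfolding \<sigma>_def by (rule bij_betw_int_remainders_mult[OF cop])
  have int_bij: "bij_betw int {1..<q} {1..<int q}"
    by (rule bij_betwI[of _ _ _ nat]) auto
  have nat_bij: "bij_betw nat {1..<int q} {1..<q}"
    by (rule bij_betwI[of _ _ _ int]) auto
  have bij: "bij_betw \<rho> {1..<q} {1..<q}"
    using bij_betw_trans[OF bij_betw_trans[OF int_bij bij\<sigma>] nat_bij]
    by (simp add: \<rho>_def o_def)
  have int_\<rho>: "int (\<rho> n) = p * int n mod int q" for n
    using q by (simp add: \<rho>_def \<sigma>_def)
  have t: "0 \<le> real n * x \<and> real n * x \<le> 1" if "n \<in> {1..<q}" for n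
  proof -
    have "real n * x \<le> real q * x"
      using that x by (intro mult_right_mono) auto
    then show ?thesis
      using x by auto
  qed
  have \<rho>_m: "\<rho> m = q - 1"
  proof -
    have "int (\<rho> m) = (- 1) mod int q"
      using cong by (simp add: int_\<rho> Cong.cong_def)
    also have "\<dots> = int q - 1"
      using q by (simp add: zmod_minus1)
    finally show ?thesis
      using q by simp
  qed
  have last: "real n * x \<le> 1 / 2" if "n \<in> {1..<q}" "\<rho> n = q - 1" for n
  proof -
    have "n = m"
      using inj_onD[OF bij_betw_imp_inj_on[OF bij], of n m] that \<rho>_m m by auto
    then show ?thesis
      using x by simp
  qed
  have factor: "\<bar>2 * sin (pi * real n * \<alpha>)\<bar> = 2 * sin (pi * (real (\<rho> n) + real n * x) / real q)"
    if n: "n \<in> {1..<q}" for n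
  proof -
    have "p * int n = int (\<rho> n) + int q * (p * int n div int q)"
      by (simp add: int_\<rho>)
    then have np: "of_int p * real n = real (\<rho> n) + real q * of_int (p * int n div int q)"
      by (metis of_int_add of_int_mult of_int_of_nat_eq)
    \<comment> \<open>Since \<open>q \<alpha> = p + x\<close>, reducing \<open>n p\<close> modulo
      \<open>q\<close> moves the angle by an integer multiple of \<open>pi\<close>, which can change
      only the sign of the sine.\<close>
    have "real n * \<alpha> = (of_int p * real n + real n * x) / real q"
      using q unfolding x(1) by (simp add: field_simps)
    also have "\<dots> = (real (\<rho> n) + real n * x) / real q + of_int (p * int n div int q)"
      unfolding np using q by (simp add: add_divide_distrib)
    finally have "pi * real n * \<alpha> =
        pi * (real (\<rho> n) + real n * x) / real q + pi * of_int (p * int n div int q)"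
      by (simp only: mult.assoc distrib_left times_divide_eq_right)
    then have "\<bar>2 * sin (pi * real n * \<alpha>)\<bar> = 2 * \<bar>sin (pi * (real (\<rho> n) + real n * x) / real q)\<bar>"
      by (simp add: abs_mult abs_sin_add_int_pi)
    moreover have "0 \<le> sin (pi * (real (\<rho> n) + real n * x) / real q)"
    proof (rule sin_ge_zero)
      have "\<rho> n < q"
        using bij_betwE[OF bij] n by auto
      then have "pi * (real (\<rho> n) + real n * x) \<le> pi * real q"
        using t[OF n] by (intro mult_left_mono) auto
      then show "pi * (real (\<rho> n) + real n * x) / real q \<le> pi"
        using q by (simp add: field_simps)
    qed (use t[OF n] in simp)
    ultimately show ?thesis
      by simp
  qed
  have prod_eq: "(\<Prod>n = 1..<q. \<bar>2 * sin (pi * real n * \<alpha>)\<bar>) =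
      (\<Prod>n = 1..<q. 2 * sin (pi * (real (\<rho> n) + real n * x) / real q))"
    by (intro prod.cong refl factor)
  show "1 \<le> (\<Prod>n = 1..<q. \<bar>2 * sin (pi * real n * \<alpha>)\<bar>)"
    unfolding prod_eq by (rule prod_perturbed_sin_ge[OF q bij t last])
  show "(\<Prod>n = 1..<q. \<bar>2 * sin (pi * real n * \<alpha>)\<bar>) \<le> (real q)\<^sup>2 / 2"
    unfolding prod_eq by (rule prod_perturbed_sin_le[OF q bij t])
qed

text \<open>Here \<open>x\<close> and \<open>y\<close> are the errors of two consecutive
  convergents. As their signs differ, the determinant identity becomes
  \<open>m \<bar>x\<bar> + q \<bar>y\<bar> = 1\<close>; with
  \<open>\<bar>x\<bar> \<le> \<bar>y\<bar>\<close> and \<open>m \<le> q\<close> this gives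
  \<open>q \<bar>x\<bar> \<le> 1\<close> and \<open>2 m \<bar>x\<bar> \<le> 1\<close>.\<close>

lemma sudler_bounds_convergent:
  fixes \<alpha> x y :: real and p p' :: int and q m :: nat
  assumes q: "2 \<le> q" and m: "1 \<le> m" "m \<le> q"
    and x: "x = real q * \<alpha> - of_int p" and y: "y = real m * \<alpha> - of_int p'"
    and det: "\<bar>int q * p' - int m * p\<bar> = 1"
    and signs: "x * y < 0" and le: "\<bar>x\<bar> \<le> \<bar>y\<bar>"
  shows "1 \<le> (\<Prod>n = 1..<q. \<bar>2 * sin (pi * real n * \<alpha>)\<bar>)
       \<and> (\<Prod>n = 1..<q. \<bar>2 * sin (pi * real n * \<alpha>)\<bar>) \<le> (real q)\<^sup>2 / 2"
proof -
  have "m \<noteq> q"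
  proof
    assume "m = q"
    with det have "int q * \<bar>p' - p\<bar> = 1"
      by (simp add: right_diff_distrib[symmetric] abs_mult)
    with q show False
      by (auto simp: zmult_eq_1_iff)
  qed
  with m have "m < q"
    by simp
  have det_xy: "real m * x - real q * y = of_int (int q * p' - int m * p)"
    unfolding x y by (simp add: algebra_simps)
  \<comment> \<open>The sign of \<open>x\<close> fixes the sign of the determinant, and so the
    residue of \<open>p m\<close> modulo \<open>q\<close>.\<close>
  have *: "int q * p' - int m * p = (if 0 < x then 1 else - 1) \<and>
      real m * \<bar>x\<bar> + real q * \<bar>y\<bar> = 1"
  proof (cases "0 < x")
    case True
    then have "y < 0"
      using signs by (simp add: mult_less_0_iff)
    have "0 < real m * x" "real q * y < 0"
      using True \<open>y < 0\<close> q m by (auto intro: mult_pos_pos mult_pos_neg)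
    then have "0 < real m * x - real q * y"
      by linarith
    then have "0 < int q * p' - int m * p"
      unfolding det_xy by (simp only: of_int_0_less_iff)
    then have "int q * p' - int m * p = 1"
      using det by linarith
    then show ?thesis
      using det_xy True \<open>y < 0\<close> by simp
  next
    case False
    then have "x < 0" "0 < y"
      using signs by (auto simp: mult_less_0_iff)
    have "real m * x < 0" "0 < real q * y"
      using \<open>x < 0\<close> \<open>0 < y\<close> q m by (auto intro: mult_pos_pos mult_pos_neg)
    then have "real m * x - real q * y < 0"
      by linarith
    then have "int q * p' - int m * p < 0"
      unfolding det_xy by (simp only: of_int_less_0_iff)
    then have "int q * p' - int m * p = - 1"
      using det by linarith
    then show ?thesis
      using det_xy \<open>x < 0\<close> \<open>0 < y\<close> by simp
  qed
  have qxy: "real q * \<bar>x\<bar> \<le> real q * \<bar>y\<bar>"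
    using le by (intro mult_left_mono) auto
  have mxy: "real m * \<bar>x\<bar> \<le> real q * \<bar>y\<bar>"
    using le m by (intro mult_mono) auto
  have "0 \<le> real m * \<bar>x\<bar>"
    by simp
  then have small: "real q * \<bar>x\<bar> \<le> 1" "2 * real m * \<bar>x\<bar> \<le> 1"
    using qxy mxy conjunct2[OF *] by linarith+
  show ?thesis
  proof (cases "0 < x")
    case True
    with * have "p * int m - (- 1) = int q * p'"
      by (simp add: algebra_simps)
    then have "[p * int m = - 1] (mod int q)"
      by (metis cong_iff_dvd_diff dvd_triv_left)
    from sudler_bounds_above_convergent[OF q m(1) \<open>m < q\<close> this x] True small show ?thesis
      by simp
  next
    \<comment> \<open>Negating \<open>\<alpha>\<close>, \<open>p\<close> and \<open>x\<close> leaves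
      the absolute values of the factors unchanged and makes the error positive.\<close>
    case False
    with * have "(- p) * int m - (- 1) = int q * (- p')"
      by (simp add: algebra_simps)
    then have "[(- p) * int m = - 1] (mod int q)"
      by (metis cong_iff_dvd_diff dvd_triv_left)
    from sudler_bounds_above_convergent[OF q m(1) \<open>m < q\<close> this, of "- x" "- \<alpha>"] False small x
    show ?thesis
      by simp
  qed
qed

section \<open>Continued fraction denominators and their approximation errors\<close>

lemma cf_rest_irrational:
  assumes "\<alpha> \<notin> \<rat>"
  shows "cf_rest \<alpha> i \<notin> \<rat>"
proof (induction i)
  case (Suc i)
  show ?case
  proof
    assume "cf_rest \<alpha> (Suc i) \<in> \<rat>"
    then have "1 / cf_rest \<alpha> (Suc i) + of_int \<lfloor>cf_rest \<alpha> i\<rfloor> \<in> \<rat>"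
      by (intro Rats_add Rats_divide Rats_1 Rats_of_int)
    also have "1 / cf_rest \<alpha> (Suc i) + of_int \<lfloor>cf_rest \<alpha> i\<rfloor> = cf_rest \<alpha> i"
      by (simp add: frac_def)
    finally show False
      using Suc by contradiction
  qed
qed (use assms in simp)

lemma frac_cf_rest:
  assumes "\<alpha> \<notin> \<rat>"
  shows "0 < frac (cf_rest \<alpha> i)" "frac (cf_rest \<alpha> i) < 1"
  using cf_rest_irrational[OF assms, of i] Ints_subset_Rats
  by (auto simp: frac_gt_0_iff frac_lt_1)

lemma cf_coeff_Suc_pos:
  assumes "\<alpha> \<notin> \<rat>"
  shows "1 \<le> cf_coeff \<alpha> (Suc i)"
  using frac_cf_rest[OF assms, of i] by (simp add: cf_coeff_def le_floor_iff)

text \<open>The tail \<open>1 / frac (cf_rest \<alpha> i)\<close> splits into its floor and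
  fractional part. This drives the recurrence for the errors.\<close>

lemma frac_mult_cf_coeff_Suc:
  assumes "\<alpha> \<notin> \<rat>"
  shows "frac (cf_rest \<alpha> i) * of_int (cf_coeff \<alpha> (Suc i)) =
    1 - frac (cf_rest \<alpha> i) * frac (cf_rest \<alpha> (Suc i))"
proof -
  have "of_int (cf_coeff \<alpha> (Suc i)) = 1 / frac (cf_rest \<alpha> i) - frac (cf_rest \<alpha> (Suc i))"
    by (simp add: cf_coeff_def frac_def)
  then show ?thesis
    using frac_cf_rest(1)[OF assms, of i] by (simp add: field_simps del: cf_rest.simps)
qed

lemma cf_denom_mono:
  assumes "\<alpha> \<notin> \<rat>"
  shows "1 \<le> cf_denom \<alpha> i \<and> cf_denom \<alpha> i \<le> cf_denom \<alpha> (Suc i)"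
proof (induction i)
  case 0
  then show ?case
    using cf_coeff_Suc_pos[OF assms, of 0] by simp
next
  case (Suc i)
  have "1 * cf_denom \<alpha> (Suc i) \<le> cf_coeff \<alpha> (Suc (Suc i)) * cf_denom \<alpha> (Suc i)"
    using Suc cf_coeff_Suc_pos[OF assms] by (intro mult_right_mono) auto
  moreover have "1 \<le> cf_denom \<alpha> i" "1 \<le> cf_denom \<alpha> (Suc i)"
    using Suc by linarith+
  ultimately show ?case
    unfolding cf_denom.simps(3) by linarith
qed

text \<open>The witnesses \<open>p\<close> and \<open>p'\<close> are the numerators of consecutive
  convergents. The error ratio \<open>- frac (cf_rest \<alpha> (Suc i))\<close> lies strictly
  between \<open>-1\<close> and \<open>0\<close>, so successive errors alternate in sign and
  shrink.\<close>

lemma cf_denom_approx: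
  assumes "\<alpha> \<notin> \<rat>"
  shows "\<exists>p p'. \<bar>cf_denom \<alpha> (Suc i) * p' - cf_denom \<alpha> i * p\<bar> = 1
    \<and> of_int (cf_denom \<alpha> (Suc i)) * \<alpha> - of_int p =
        - frac (cf_rest \<alpha> (Suc i)) * (of_int (cf_denom \<alpha> i) * \<alpha> - of_int p')
    \<and> of_int (cf_denom \<alpha> i) * \<alpha> - of_int p' \<noteq> 0"
proof (induction i)
  case 0
  have "of_int (cf_coeff \<alpha> 1) * frac \<alpha> - 1 = - frac (cf_rest \<alpha> (Suc 0)) * frac \<alpha>"
    using frac_mult_cf_coeff_Suc[OF assms, of 0] by (simp add: mult.commute)
  then have "of_int (cf_coeff \<alpha> 1) * \<alpha> - of_int (cf_coeff \<alpha> 1 * \<lfloor>\<alpha>\<rfloor> + 1) =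
      - frac (cf_rest \<alpha> (Suc 0)) * (\<alpha> - of_int \<lfloor>\<alpha>\<rfloor>)"
    by (simp add: frac_def algebra_simps)
  moreover have "\<alpha> - of_int \<lfloor>\<alpha>\<rfloor> \<noteq> 0"
    using frac_cf_rest(1)[OF assms, of 0] by (simp add: frac_def)
  ultimately show ?case
    by (intro exI[of _ "cf_coeff \<alpha> 1 * \<lfloor>\<alpha>\<rfloor> + 1"] exI[of _ "\<lfloor>\<alpha>\<rfloor>"]) (simp del: cf_rest.simps)
next
  case (Suc i)
  then obtain p p' where
    det: "\<bar>cf_denom \<alpha> (Suc i) * p' - cf_denom \<alpha> i * p\<bar> = 1"
    and approx: "of_int (cf_denom \<alpha> (Suc i)) * \<alpha> - of_int p =
        - frac (cf_rest \<alpha> (Suc i)) * (of_int (cf_denom \<alpha> i) * \<alpha> - of_int p')"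
    and nz: "of_int (cf_denom \<alpha> i) * \<alpha> - of_int p' \<noteq> 0"
    by blast
  define a where "a = cf_coeff \<alpha> (Suc (Suc i))"
  define d where "d = of_int (cf_denom \<alpha> i) * \<alpha> - of_int p'"
  define f where "f = frac (cf_rest \<alpha> (Suc i))"
  \<comment> \<open>The next numerator is \<open>a * p + p'\<close>, by the same recurrence as the
    denominators, so the errors obey that recurrence too.\<close>
  have "of_int (cf_denom \<alpha> (Suc (Suc i))) * \<alpha> - of_int (a * p + p') =
      of_int a * (of_int (cf_denom \<alpha> (Suc i)) * \<alpha> - of_int p) + d"
    by (simp add: a_def d_def algebra_simps)
  also have "\<dots> = d * (1 - f * of_int a)"
    unfolding approx by (simp add: d_def f_def algebra_simps del: cf_rest.simps)
  also have "\<dots> = - frac (cf_rest \<alpha> (Suc (Suc i))) * (- f * d)"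
    unfolding f_def a_def frac_mult_cf_coeff_Suc[OF assms] by (simp del: cf_rest.simps)
  also have "- f * d = of_int (cf_denom \<alpha> (Suc i)) * \<alpha> - of_int p"
    using approx by (simp add: f_def d_def)
  finally have 1: "of_int (cf_denom \<alpha> (Suc (Suc i))) * \<alpha> - of_int (a * p + p') =
      - frac (cf_rest \<alpha> (Suc (Suc i))) * (of_int (cf_denom \<alpha> (Suc i)) * \<alpha> - of_int p)" .
  have 2: "of_int (cf_denom \<alpha> (Suc i)) * \<alpha> - of_int p \<noteq> 0"
    unfolding approx using nz frac_cf_rest(1)[OF assms, of "Suc i"]
    by (simp del: cf_rest.simps cf_denom.simps)
  have "cf_denom \<alpha> (Suc (Suc i)) * p - cf_denom \<alpha> (Suc i) * (a * p + p') =
      - (cf_denom \<alpha> (Suc i) * p' - cf_denom \<alpha> i * p)"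
    by (simp add: a_def algebra_simps)
  then have "\<bar>cf_denom \<alpha> (Suc (Suc i)) * p - cf_denom \<alpha> (Suc i) * (a * p + p')\<bar> = 1"
    using det by (metis abs_minus_cancel)
  with 1 2 show ?case
    by blast
qed

theorem theorem3:
  fixes \<alpha> :: real and q :: nat
  assumes "\<alpha> \<notin> \<rat>"
    and "best_approx_denom \<alpha> q"
  shows "1 \<le> (\<Prod>n = 1..q - 1. \<bar>2 * sin (pi * real n * \<alpha>)\<bar>)
       \<and> (q \<noteq> 1 \<longrightarrow> (\<Prod>n = 1..q - 1. \<bar>2 * sin (pi * real n * \<alpha>)\<bar>) \<le> (real q)\<^sup>2 / 2)"
proof (cases "q = 1")
  case False
  obtain j where j: "int q = cf_denom \<alpha> j"
    using assms(2) by (auto simp: best_approx_denom_def)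
  \<comment> \<open>The denominator of index \<open>0\<close> is \<open>1\<close>, so
    \<open>q \<noteq> 1\<close> guarantees a preceding convergent.\<close>
  with False obtain i where i: "j = Suc i"
    by (cases j) auto
  define m where "m = nat (cf_denom \<alpha> i)"
  have m: "int m = cf_denom \<alpha> i" "1 \<le> m" "m \<le> q"
    using cf_denom_mono[OF assms(1), of i] j unfolding i m_def by linarith+
  have q: "2 \<le> q"
    using m False by linarith
  have real_qm: "of_int (cf_denom \<alpha> (Suc i)) = real q" "of_int (cf_denom \<alpha> i) = real m"
    using j i m(1) by (metis of_int_of_nat_eq)+
  obtain p p' where
    det: "\<bar>int q * p' - int m * p\<bar> = 1"
    and approx: "real q * \<alpha> - of_int p =
        - frac (cf_rest \<alpha> (Suc i)) * (real m * \<alpha> - of_int p')"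
    and nz: "real m * \<alpha> - of_int p' \<noteq> 0"
    using cf_denom_approx[OF assms(1), of i] m(1) j i real_qm by metis
  define y where "y = real m * \<alpha> - of_int p'"
  define f where "f = frac (cf_rest \<alpha> (Suc i))"
  have f: "0 < f" "f < 1"
    using frac_cf_rest[OF assms(1), of "Suc i"] by (simp_all only: f_def)
  have x: "real q * \<alpha> - of_int p = - f * y"
    using approx by (simp only: f_def y_def)
  have "- f * y * y < 0"
    using f nz by (auto simp: y_def mult.assoc mult_less_0_iff zero_less_mult_iff linorder_neq_iff)
  moreover have "\<bar>- f * y\<bar> \<le> \<bar>y\<bar>"
    using f by (simp add: abs_mult mult_left_le_one_le)
  ultimately have "1 \<le> (\<Prod>n = 1..<q. \<bar>2 * sin (pi * real n * \<alpha>)\<bar>)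
       \<and> (\<Prod>n = 1..<q. \<bar>2 * sin (pi * real n * \<alpha>)\<bar>) \<le> (real q)\<^sup>2 / 2"
    using sudler_bounds_convergent[OF q m(2,3) x[symmetric] y_def det] by blast
  moreover have "{1..q - 1} = {1..<q}"
    using q by auto
  ultimately show ?thesis
    by simp
\<comment> \<open>For \<open>q = 1\<close> the product is empty and equals \<open>1\<close>; the
  upper bound, which would be \<open>1 / 2\<close>, is not claimed there.\<close>
qed simp

end
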